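(* Let $\mathcal R$ be a divisible ELT field and let $A\in(\overline{\mathcal R})^{n\times n}$. If $A$ is ELT nilpotent, then $s(\operatorname{etr}(A))=0$.
   Context: Let $F$ be a totally ordered abelian group (written additively) which is divisible, and $L$ a field. The divisible ELT field $\mathcal R=\mathscr R(L,F)$ is the set of symbols ${}^{[\ell]}a$ ($a\in F$, $\ell\in L$) with multiplication ${}^{[\ell_1]}a_1\cdot{}^{[\ell_2]}a_2={}^{[\ell_1\ell_2]}(a_1+a_2)$ and addition ${}^{[\ell_1]}a_1+{}^{[\ell_2]}a_2$ equal to ${}^{[\ell_1]}a_1$ if $a_1>a_2$, to ${}^{[\ell_2]}a_2$ if $a_1<a_2$, and to ${}^{[\ell_1+\ell_2]}a_1$ if $a_1=a_2$. Write $s({}^{[\ell]}a)=\ell$ (layer) and $\tau({}^{[\ell]}a)=a$ (tangible value). Set $\overline{\mathcal R}=\mathcal R\cup\{-\infty\}$, where $-\infty+\alpha=\alpha+(-\infty)=\alpha$, $-\infty\cdot\alpha=\alpha\cdot(-\infty)=-\infty$, $s(-\infty)=0$ and $\tau(-\infty)=-\infty$, smaller than every element of $F$, with $\frac{-\infty}{k}=-\infty$ for $k\ge1$; the symbol ${}^{[0]}(-\infty)$ means $-\infty$. $A$ is ELT nilpotent if there is $m\ge 1$ such that all entries of $A^m$ have layer $0$. The determinant is $\det(A)=\sum_{\sigma\in S_n}{}^{[\operatorname{sgn}\sigma]}0\cdot a_{1,\sigma(1)}\cdots a_{n,\sigma(n)}$, the trace is $\operatorname{tr}(A)=\sum_i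 a_{i,i}$, and the ELT characteristic polynomial is $p_A(\lambda)=\det(\lambda I_n+{}^{[-1]}0\cdot A)=\lambda^n+\sum_{i=1}^n\alpha_i\lambda^{n-i}\in\overline{\mathcal R}[\lambda]$ (so $\alpha_1={}^{[-1]}0\cdot\operatorname{tr}(A)$). For a polynomial $p$ over $\overline{\mathcal R}$ and a monomial $h$ of $p$, let $p_h$ be the sum of the other monomials of $p$. The monomial $h$ is essential at $a\in\mathcal R$ if $p(a)=h(a)$ and $\tau(p_h(a))<\tau(p(a))$; $h$ is essential in $p$ if it is essential at some $a\in\mathcal R$. Let $\mu=\mu(A)$ be the smallest $\ell\in\{1,\dots,n\}$ such that $\frac{\tau(\alpha_\ell)}{\ell}\ge\frac{\tau(\alpha_k)}{k}$ for all $1\le k\le n$. The essential trace is $\operatorname{etr}(A)=\operatorname{tr}(A)$ if the monomial ${}^{[-1]}0\cdot\operatorname{tr}(A)\lambda^{n-1}$ is essential in $p_A(\lambda)$, and $\operatorname{etr}(A)={}^{[0]}\big(\tfrac{\tau(\alpha_\mu)}{\mu}\big)$ otherwise. *)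

theory Defs
  imports
    "Jordan_Normal_Form.Matrix"
    "HOL-Computational_Algebra.Polynomial"
    "HOL-Combinatorics.Permutations"
    "HOL-Library.Lattice_Constructions"
begin

section \<open>Divisible totally ordered abelian groups\<close>

class divisible_linordered_ab_group_add = linordered_ab_group_add +
  assumes divisible: "0 < k \<Longrightarrow> \<exists>y. (\<Sum>i<(k::nat). y) = x"

text \<open>The quotient is unique because an ordered group is torsion-free.\<close>

definition nat_quotient :: "'f::divisible_linordered_ab_group_add \<Rightarrow> nat \<Rightarrow> 'f"
  where "nat_quotient x k = (THE y. (\<Sum>i<k. y) = x)"

lemma sum_const_strict_mono:
  fixes x y :: "'f::linordered_ab_group_add"
  assumes "0 < k" "x < y"
  shows "(\<Sum>i<k. x) < (\<Sum>i<(k::nat). y)"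
  using assms by (intro sum_strict_mono) auto

lemma nat_quotient_unique:
  assumes "0 < k" "(\<Sum>i<k. y) = x"
  shows "nat_quotient x k = y"
  unfolding nat_quotient_def
proof (rule the_equality)
  show "(\<Sum>i<k. y) = x" by fact
  show "z = y" if z: "(\<Sum>i<k. z) = x" for z
  proof (cases z y rule: linorder_cases)
    case less
    from sum_const_strict_mono[OF assms(1) less] have "x < x" unfolding z assms(2) .
    then show ?thesis by simp
  next
    case greater
    from sum_const_strict_mono[OF assms(1) greater] have "x < x" unfolding z assms(2) .
    then show ?thesis by simp
  qed
qed

lemma sum_nat_quotient:
  assumes "0 < k"
  shows "(\<Sum>i<k. nat_quotient x k) = x"
proof -
  obtain y where y: "(\<Sum>i<k. y) = x"
    using divisible[OF assms] by blast
  show ?thesis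
    unfolding nat_quotient_unique[OF assms y] by (rule y)
qed

section \<open>The semiring of ELT symbols with minus infinity adjoined\<close>

text \<open>
  \<open>Elt l a\<close> is the symbol with layer \<open>l\<close> and tangible value \<open>a\<close>. The ELT field itself
  consists of the elements other than \<open>MinusInf\<close>.
\<close>

datatype ('l, 'f) elt = Elt 'l 'f | MinusInf

instantiation elt :: (field, linordered_ab_group_add) comm_semiring_1
begin

definition zero_elt :: "('a, 'b) elt" where "0 = MinusInf"

definition one_elt :: "('a, 'b) elt" where "1 = Elt 1 0"

fun plus_elt :: "('a, 'b) elt \<Rightarrow> ('a, 'b) elt \<Rightarrow> ('a, 'b) elt" where
  "Elt k a + Elt l b = (if b < a then Elt k a else if a < b then Elt l b else Elt (k + l) a)"
| "MinusInf + y = y"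
| "x + MinusInf = x"

fun times_elt :: "('a, 'b) elt \<Rightarrow> ('a, 'b) elt \<Rightarrow> ('a, 'b) elt" where
  "Elt k a * Elt l b = Elt (k * l) (a + b)"
| "MinusInf * y = MinusInf"
| "x * MinusInf = MinusInf"

lemma plus_MinusInf_right [simp]: "x + MinusInf = x" for x :: "('a, 'b) elt"
  by (cases x) auto

lemma times_MinusInf_right [simp]: "x * MinusInf = MinusInf" for x :: "('a, 'b) elt"
  by (cases x) auto

instance
proof
  fix a b c :: "('a, 'b) elt"
  show "a * b * c = a * (b * c)"
    by (cases a; cases b; cases c) (auto simp: algebra_simps)
  show "a * b = b * a"
    by (cases a; cases b) (auto simp: algebra_simps)
  show "1 * a = a"
    by (cases a) (auto simp: one_elt_def)
  show "a + b + c = a + (b + c)"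
    by (cases a; cases b; cases c) (auto simp: algebra_simps)
  show "a + b = b + a"
    by (cases a; cases b) (auto simp: algebra_simps)
  show "0 + a = a" "0 * a = 0" "a * 0 = 0"
    by (auto simp: zero_elt_def)
  show "(a + b) * c = a * c + b * c"
    by (cases a; cases b; cases c) (auto simp: algebra_simps)
  show "(0 :: ('a, 'b) elt) \<noteq> 1"
    by (auto simp: zero_elt_def one_elt_def)
qed

end

fun layer :: "('l::zero, 'f) elt \<Rightarrow> 'l" where
  "layer (Elt l a) = l"
| "layer MinusInf = 0"

text \<open>\<open>Bot\<close> is the value minus infinity, smaller than every \<open>Value a\<close>.\<close>

fun tangible :: "('l, 'f) elt \<Rightarrow> 'f bot" where
  "tangible (Elt l a) = bot.Value a"
| "tangible MinusInf = bot.Bot"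

fun bot_quotient :: "'f::divisible_linordered_ab_group_add bot \<Rightarrow> nat \<Rightarrow> 'f bot" where
  "bot_quotient (bot.Value a) k = bot.Value (nat_quotient a k)"
| "bot_quotient bot.Bot k = bot.Bot"

fun layer_zero_symbol :: "'f bot \<Rightarrow> ('l::zero, 'f) elt" where
  "layer_zero_symbol (bot.Value a) = Elt 0 a"
| "layer_zero_symbol bot.Bot = MinusInf"

section \<open>Matrices and the characteristic polynomial\<close>

definition elt_nilpotent :: "('l::field, 'f::linordered_ab_group_add) elt mat \<Rightarrow> bool" where
  "elt_nilpotent A \<longleftrightarrow> (\<exists>m\<ge>1. \<forall>x \<in> elements_mat (A ^\<^sub>m m). layer x = 0)"

definition elt_trace :: "('l::field, 'f::linordered_ab_group_add) elt mat \<Rightarrow> ('l, 'f) elt" where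
  "elt_trace A = (\<Sum>i<dim_row A. A $$ (i, i))"

text \<open>
  The parameter \<open>emb\<close> embeds the symbols into the semiring \<open>'a\<close> of matrix entries, so that the
  same formula gives determinants of matrices of symbols (\<open>emb\<close> the identity) and of matrices of
  polynomials (\<open>emb\<close> the constant polynomials).
\<close>

definition elt_det_over ::
    "(('l::field, 'f::linordered_ab_group_add) elt \<Rightarrow> 'a::comm_semiring_1) \<Rightarrow> 'a mat \<Rightarrow> 'a" where
  "elt_det_over emb A =
    (\<Sum>\<sigma> | \<sigma> permutes {..<dim_row A}.
      emb (Elt (of_int (sign \<sigma>)) 0) * (\<Prod>i<dim_row A. A $$ (i, \<sigma> i)))"

definition elt_det :: "('l::field, 'f::linordered_ab_group_add) elt mat \<Rightarrow> ('l, 'f) elt" where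
  "elt_det A = elt_det_over (\<lambda>x. x) A"

text \<open>
  The indeterminate is \<open>monom 1 1\<close>; the zero and one of the coefficients are \<open>MinusInf\<close> and
  \<open>Elt 1 0\<close>.
\<close>

definition elt_char_poly ::
    "('l::field, 'f::linordered_ab_group_add) elt mat \<Rightarrow> ('l, 'f) elt poly" where
  "elt_char_poly A =
    elt_det_over (\<lambda>x. [:x:])
      (monom 1 1 \<cdot>\<^sub>m 1\<^sub>m (dim_row A) + map_mat (\<lambda>x. [:x:]) (Elt (-1) 0 \<cdot>\<^sub>m A))"

definition char_coeff ::
    "('l::field, 'f::linordered_ab_group_add) elt mat \<Rightarrow> nat \<Rightarrow> ('l, 'f) elt" where
  "char_coeff A i = coeff (elt_char_poly A) (dim_row A - i)"

section \<open>Essential monomials\<close>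

text \<open>
  A monomial of \<open>p\<close> is identified by its exponent \<open>i\<close>. If its coefficient is \<open>MinusInf\<close> it
  cannot be essential, since no value lies below \<open>Bot\<close>.
\<close>

definition other_monomials ::
    "('l::field, 'f::linordered_ab_group_add) elt poly \<Rightarrow> nat \<Rightarrow> ('l, 'f) elt poly" where
  "other_monomials p i = (\<Sum>j \<in> {..degree p} - {i}. monom (coeff p j) j)"

definition essential_at ::
    "('l::field, 'f::linordered_ab_group_add) elt poly \<Rightarrow> nat \<Rightarrow> ('l, 'f) elt \<Rightarrow> bool" where
  "essential_at p i a \<longleftrightarrow>
    poly p a = poly (monom (coeff p i) i) a \<and>
    tangible (poly (other_monomials p i) a) < tangible (poly p a)"

definition essential ::
    "('l::field, 'f::linordered_ab_group_add) elt poly \<Rightarrow> nat \<Rightarrow> bool" where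
  "essential p i \<longleftrightarrow> (\<exists>a. a \<noteq> MinusInf \<and> essential_at p i a)"

section \<open>The essential trace\<close>

definition char_slope ::
    "('l::field, 'f::divisible_linordered_ab_group_add) elt mat \<Rightarrow> nat \<Rightarrow> 'f bot" where
  "char_slope A k = bot_quotient (tangible (char_coeff A k)) k"

definition elt_mu :: "('l::field, 'f::divisible_linordered_ab_group_add) elt mat \<Rightarrow> nat" where
  "elt_mu A =
    (LEAST l. l \<in> {1..dim_row A} \<and> (\<forall>k \<in> {1..dim_row A}. char_slope A k \<le> char_slope A l))"

text \<open>
  For a square matrix of size \<open>n\<close>, the monomial of degree \<open>n - 1\<close> in the characteristic
  polynomial is the one with coefficient \<open>char_coeff A 1 = Elt (-1) 0 * elt_trace A\<close>.
\<close>

lemma coeff_prod_linear: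
  fixes c :: "nat \<Rightarrow> 'a::comm_semiring_1"
  shows "coeff (\<Prod>i<n. [:c i, 1:]) n = 1 \<and> degree (\<Prod>i<n. [:c i, 1:]) \<le> n \<and>
    (n \<ge> 1 \<longrightarrow> coeff (\<Prod>i<n. [:c i, 1:]) (n - 1) = (\<Sum>i<n. c i))"
proof (induction n)
  case 0
  show ?case by simp
next
  case (Suc n)
  let ?p = "\<Prod>i<n. [:c i, 1:]"
  have eq: "(\<Prod>i<Suc n. [:c i, 1:]) = smult (c n) ?p + pCons 0 ?p"
    by (simp add: mult.commute)
  have "degree (smult (c n) ?p + pCons 0 ?p) \<le> Suc n"
    using Suc.IH degree_smult_le[of "c n" ?p] degree_pCons_le[of 0 ?p]
    by (intro degree_add_le) linarith+
  moreover have "coeff ?p (Suc n) = 0"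
    using Suc.IH by (intro coeff_eq_0) linarith
  moreover have "coeff (smult (c n) ?p + pCons 0 ?p) n = (\<Sum>i<Suc n. c i)"
    using Suc.IH by (cases n) (simp_all add: add.commute)
  ultimately show ?case
    unfolding eq using Suc.IH by simp
qed

lemma char_matrix_entry:
  assumes "A \<in> carrier_mat n n" "i < n" "j < n"
  shows "(monom 1 1 \<cdot>\<^sub>m 1\<^sub>m (dim_row A) + map_mat (\<lambda>x. [:x:]) (Elt (-1) 0 \<cdot>\<^sub>m A)) $$ (i, j) =
    [:Elt (-1) 0 * A $$ (i, j), if i = j then 1 else 0:]"
  using assms by (auto simp: monom_altdef)

lemma char_coeff_1:
  fixes A :: "('l::field, 'f::linordered_ab_group_add) elt mat"
  assumes A: "A \<in> carrier_mat n n" and n: "n \<ge> 1"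
  shows "char_coeff A 1 = Elt (-1) 0 * elt_trace A"
proof -
  define c where "c i j = Elt (-1) 0 * A $$ (i, j)" for i j
  define P where "P \<sigma> = (\<Prod>i<n. [:c i (\<sigma> i), if i = \<sigma> i then 1 else 0:])" for \<sigma> :: "nat \<Rightarrow> nat"
  let ?s = "\<lambda>\<sigma>. Elt (of_int (sign \<sigma>)) 0 :: ('l, 'f) elt"
  have char: "elt_char_poly A = (\<Sum>\<sigma> | \<sigma> permutes {..<n}. [:?s \<sigma>:] * P \<sigma>)"
    unfolding elt_char_poly_def elt_det_over_def P_def
  proof (intro sum.cong arg_cong2[where f = "(*)"] prod.cong)
    fix \<sigma> i assume "\<sigma> \<in> {\<sigma>. \<sigma> permutes {..<n}}" "i \<in> {..<n}"
    then have "i < n" "\<sigma> i < n" using permutes_in_image[of \<sigma> "{..<n}" i] by auto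
    then show "(monom 1 1 \<cdot>\<^sub>m 1\<^sub>m (dim_row A) + map_mat (\<lambda>x. [:x:]) (Elt (-1) 0 \<cdot>\<^sub>m A)) $$ (i, \<sigma> i) =
        [:c i (\<sigma> i), if i = \<sigma> i then 1 else 0:]"
      using char_matrix_entry[OF A, of i "\<sigma> i"] by (simp add: c_def)
  qed (use A in auto)
  have vanish: "coeff (P \<sigma>) (n - 1) = 0" if \<sigma>: "\<sigma> permutes {..<n}" and "\<sigma> \<noteq> id" for \<sigma>
  proof -
    obtain i where i: "\<sigma> i \<noteq> i" using \<open>\<sigma> \<noteq> id\<close> by fastforce
    then have i': "\<sigma> (\<sigma> i) \<noteq> \<sigma> i" using permutes_inj[OF \<sigma>] by (auto dest: injD)
    have in_n: "i < n" "\<sigma> i < n"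
      using \<sigma> i permutes_in_image[OF \<sigma>, of i] by (auto simp: permutes_def)
    have "degree (P \<sigma>) \<le> (\<Sum>k<n. degree [:c k (\<sigma> k), if k = \<sigma> k then 1 else 0:])"
      unfolding P_def by (rule order_trans[OF degree_prod_sum_le]) (simp_all add: o_def)
    also have "\<dots> \<le> (\<Sum>k<n. if k = \<sigma> k then 1 else 0)"
      by (intro sum_mono) auto
    also have "\<dots> = card {k \<in> {..<n}. k = \<sigma> k}"
      by (simp add: sum.If_cases Int_def)
    also have "\<dots> \<le> card ({..<n} - {i, \<sigma> i})"
      using i i' by (intro card_mono) auto
    also have "\<dots> = n - 2"
      using in_n i by (subst card_Diff_subset) auto
    also have "n - 2 < n - 1" using in_n i by auto
    finally show ?thesis by (intro coeff_eq_0)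
  qed
  have "char_coeff A 1 = (\<Sum>\<sigma> | \<sigma> permutes {..<n}. ?s \<sigma> * coeff (P \<sigma>) (n - 1))"
    using A by (auto simp: char_coeff_def char coeff_sum)
  also have "\<dots> = (\<Sum>\<sigma> \<in> {id}. ?s \<sigma> * coeff (P \<sigma>) (n - 1))"
  proof (rule sum.mono_neutral_right)
    show "\<forall>\<sigma> \<in> {\<sigma>. \<sigma> permutes {..<n}} - {id}. ?s \<sigma> * coeff (P \<sigma>) (n - 1) = 0"
      using vanish by (metis Diff_iff insertI1 mem_Collect_eq mult_zero_right)
  qed (auto simp: finite_permutations)
  also have "\<dots> = coeff (P id) (n - 1)"
    by (simp add: sign_id flip: one_elt_def)
  also have "\<dots> = (\<Sum>i<n. c i i)"
    using coeff_prod_linear[of "\<lambda>i. c i i" n] n by (simp add: P_def)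
  also have "\<dots> = Elt (-1) 0 * elt_trace A"
    using A by (auto simp: c_def elt_trace_def sum_distrib_left)
  finally show ?thesis .
qed

definition essential_trace ::
    "('l::field, 'f::divisible_linordered_ab_group_add) elt mat \<Rightarrow> ('l, 'f) elt" where
  "essential_trace A =
    (if essential (elt_char_poly A) (dim_row A - 1) then elt_trace A
     else layer_zero_symbol (char_slope A (elt_mu A)))"

end

theory Submission
  imports Defs "HOL-Combinatorics.Cycles"
begin

text \<open>
  If the trace monomial is not essential, then \<open>essential_trace A\<close> is by construction a symbol of
  layer zero (or minus infinity). So suppose that it is essential, and write \<open>T\<close> for the trace.

  ELT addition never lowers tangible values: layers may cancel, but the tangible value of a sum is
  the maximum of those of its terms. Hence the tangible value of the coefficient \<open>\<alpha>\<^sub>k\<close> is at least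
  the weight of every permutation of \<open>k\<close> indices
  (\<open>tangible_permutation_le_char_coeff\<close>). Essentiality of the trace monomial at a point \<open>a\<close>
  says, when compared with \<open>\<lambda>\<^sup>n\<close>, that \<open>\<tau>(a) < \<tau>(T)\<close>, and when compared with
  \<open>\<alpha>\<^sub>k \<lambda>\<^bsup>n-k\<^esup>\<close>, that \<open>\<tau>(\<alpha>\<^sub>k) < \<tau>(T) + (k-1) \<tau>(a)\<close>. Therefore \<open>\<tau>(\<alpha>\<^sub>k) < k \<tau>(T)\<close> for all
  \<open>k \<ge> 2\<close> (\<open>char_coeff_less_trace_power\<close>).

  In terms of the weighted digraph of \<open>A\<close>: two loops cannot both have weight \<open>\<tau>(T)\<close>, since
  together they form a permutation of two indices. So a single vertex \<open>c\<close> carries a loop of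
  weight \<open>\<tau>(T)\<close>, the trace equals \<open>A\<^bsub>cc\<^esub>\<close>, and every other simple cycle has mean weight below
  \<open>\<tau>(T)\<close>. Closed walks decompose into simple cycles, so the only closed walk of length \<open>m\<close> and
  weight \<open>m \<tau>(T)\<close> is the one that stays at \<open>c\<close> (\<open>closed_walk_less\<close>). In the entry \<open>(c, c)\<close> of
  \<open>A\<^sup>m\<close> that walk dominates all others strictly, so nothing is added to its layer and the entry is
  \<open>T\<^sup>m\<close> (\<open>pow_mat_critical_entry\<close>). If \<open>A\<close> is nilpotent, some \<open>m\<close> gives \<open>s(T)\<^sup>m = 0\<close>, and
  \<open>s(T) = 0\<close> because the layers form a field.
\<close>

section \<open>Tangible values\<close>

lemma tangible_add: "tangible (x + y) = max (tangible x) (tangible y)"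
  for x y :: "('l::field, 'f::linordered_ab_group_add) elt"
  by (cases x; cases y) (auto simp: max_def)

lemma tangible_eq_Bot_iff [simp]: "tangible x = bot.Bot \<longleftrightarrow> x = 0"
  for x :: "('l::field, 'f::linordered_ab_group_add) elt"
  by (cases x) (auto simp: zero_elt_def)

lemma tangible_zero [simp]: "tangible (0 :: ('l::field, 'f::linordered_ab_group_add) elt) = bot.Bot"
  by simp

lemma tangible_zero_less: "tangible (0 :: ('l, 'f) elt) < tangible y \<longleftrightarrow> y \<noteq> 0"
  for y :: "('l::field, 'f::linordered_ab_group_add) elt"
  by (cases y) (auto simp: zero_elt_def)

lemma elt_mult_eq_0_iff: "x * y = 0 \<longleftrightarrow> x = 0 \<or> y = 0"
  for x y :: "('l::field, 'f::linordered_ab_group_add) elt"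
  by (cases x; cases y) (auto simp: zero_elt_def)

lemma elt_power_not_zero: "x \<noteq> 0 \<Longrightarrow> x ^ k \<noteq> 0"
  for x :: "('l::field, 'f::linordered_ab_group_add) elt"
  by (induction k) (auto simp: elt_mult_eq_0_iff)

lemma tangible_mult_mono:
  fixes x y x' y' :: "('l::field, 'f::linordered_ab_group_add) elt"
  assumes "tangible x \<le> tangible x'" "tangible y \<le> tangible y'"
  shows "tangible (x * y) \<le> tangible (x' * y')"
  using assms by (cases x; cases y; cases x'; cases y') (auto intro: add_mono)

lemma tangible_mult_cong:
  fixes x y x' y' :: "('l::field, 'f::linordered_ab_group_add) elt"
  assumes "tangible x = tangible x'" "tangible y = tangible y'"
  shows "tangible (x * y) = tangible (x' * y')"
  using assms by (intro antisym tangible_mult_mono) auto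

lemma tangible_power_mono:
  fixes x y :: "('l::field, 'f::linordered_ab_group_add) elt"
  assumes "tangible x \<le> tangible y"
  shows "tangible (x ^ k) \<le> tangible (y ^ k)"
  using assms by (induction k) (auto intro: tangible_mult_mono)

lemma tangible_mult_less_cancel_right:
  "z \<noteq> 0 \<Longrightarrow> tangible (x * z) < tangible (y * z) \<longleftrightarrow> tangible x < tangible y"
  for x y z :: "('l::field, 'f::linordered_ab_group_add) elt"
  by (cases x; cases y; cases z) (auto simp: zero_elt_def)

lemma tangible_mult_less_le:
  fixes x y x' y' :: "('l::field, 'f::linordered_ab_group_add) elt"
  assumes "tangible x < tangible x'" "tangible y \<le> tangible y'" "y' \<noteq> 0"
  shows "tangible (x * y) < tangible (x' * y')"
  using assms
  by (cases x; cases y; cases x'; cases y') (auto simp: zero_elt_def intro: add_less_le_mono)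

lemma tangible_le_sum:
  fixes f :: "'i \<Rightarrow> ('l::field, 'f::linordered_ab_group_add) elt"
  assumes "finite I" "i \<in> I"
  shows "tangible (f i) \<le> tangible (sum f I)"
  using assms by (simp add: sum.remove tangible_add)

lemma tangible_sum_less:
  fixes f :: "'i \<Rightarrow> ('l::field, 'f::linordered_ab_group_add) elt"
  assumes "y \<noteq> 0" "\<And>i. i \<in> I \<Longrightarrow> tangible (f i) < tangible y"
  shows "tangible (sum f I) < tangible y"
  using assms(2)
  by (induction I rule: infinite_finite_induct)
    (use assms(1) tangible_zero_less[of y] in \<open>auto simp: tangible_add\<close>)

text \<open>
  Together with \<open>tangible_le_sum\<close>, this says that the tangible value of a sum is the maximum of
  those of its terms. The hypothesis excludes the empty sum, where no term attains the value.
\<close>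

lemma tangible_sum_attained:
  fixes f :: "'i \<Rightarrow> ('l::field, 'f::linordered_ab_group_add) elt"
  assumes "sum f I \<noteq> 0"
  shows "\<exists>i\<in>I. tangible (f i) = tangible (sum f I)"
proof (rule ccontr)
  assume none: "\<not> ?thesis"
  have fin: "finite I" using assms by (metis sum.infinite)
  have "tangible (f i) < tangible (sum f I)" if "i \<in> I" for i
    using tangible_le_sum[OF fin that, of f] none that by (simp add: order_le_less)
  then have "tangible (sum f I) < tangible (sum f I)"
    by (rule tangible_sum_less[OF assms])
  then show False by simp
qed

lemma elt_add_absorb: "tangible y < tangible x \<Longrightarrow> x + y = x"
  for x y :: "('l::field, 'f::linordered_ab_group_add) elt"
  by (cases x; cases y) auto

text \<open>
  The layer of a sum is the sum of the layers of the terms of maximal tangible value. With only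
  one such term, its layer survives unchanged.
\<close>

lemma sum_eq_dominant_term:
  fixes f :: "'i \<Rightarrow> ('l::field, 'f::linordered_ab_group_add) elt"
  assumes "finite I" "i \<in> I" "f i \<noteq> 0"
    and "\<And>j. j \<in> I \<Longrightarrow> j \<noteq> i \<Longrightarrow> tangible (f j) < tangible (f i)"
  shows "sum f I = f i"
proof -
  have "tangible (sum f (I - {i})) < tangible (f i)"
    using assms by (intro tangible_sum_less) auto
  then show ?thesis using assms by (simp add: sum.remove elt_add_absorb)
qed

lemma layer_power: "x \<noteq> 0 \<Longrightarrow> layer (x ^ k) = layer x ^ k"
  for x :: "('l::field, 'f::linordered_ab_group_add) elt"
proof (induction k)
  case 0
  show ?case by (simp add: one_elt_def)
next
  case (Suc k)
  have "layer (x * y) = layer x * layer y" for y by (cases x; cases y) auto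
  with Suc show ?case by simp
qed

section \<open>Coefficients of the characteristic polynomial\<close>

lemma elt_char_poly_expansion:
  fixes A :: "('l::field, 'f::linordered_ab_group_add) elt mat"
  assumes A: "A \<in> carrier_mat n n"
  shows "elt_char_poly A = (\<Sum>\<sigma> | \<sigma> permutes {..<n}. [:Elt (of_int (sign \<sigma>)) 0:] *
    (\<Prod>i<n. [:Elt (-1) 0 * A $$ (i, \<sigma> i), if i = \<sigma> i then 1 else 0:]))"
  unfolding elt_char_poly_def elt_det_over_def
proof (intro sum.cong arg_cong2[where f = "(*)"] prod.cong)
  fix \<sigma> i assume "\<sigma> \<in> {\<sigma>. \<sigma> permutes {..<n}}" "i \<in> {..<n}"
  then have "i < n" "\<sigma> i < n" using permutes_in_image[of \<sigma> "{..<n}" i] by auto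
  then show "(monom 1 1 \<cdot>\<^sub>m 1\<^sub>m (dim_row A) + map_mat (\<lambda>x. [:x:]) (Elt (-1) 0 \<cdot>\<^sub>m A)) $$ (i, \<sigma> i) =
      [:Elt (-1) 0 * A $$ (i, \<sigma> i), if i = \<sigma> i then 1 else 0:]"
    using A by (intro char_matrix_entry)
qed (use A in auto)

text \<open>
  Expanding the product, the left-hand side is one of the terms that contribute to the
  coefficient on the right: take the constant \<open>c i\<close> from the factors in \<open>S\<close> and the linear term
  from the others. Adding the remaining terms cannot lower the tangible value.
\<close>

lemma tangible_le_coeff_prod_linear:
  fixes c d :: "'i \<Rightarrow> ('l::field, 'f::linordered_ab_group_add) elt"
  assumes "finite I" "S \<subseteq> I"
  shows "tangible ((\<Prod>i\<in>S. c i) * (\<Prod>i\<in>I - S. d i)) \<le>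
    tangible (coeff (\<Prod>i\<in>I. [:c i, d i:]) (card (I - S)))"
  using assms
proof (induction I arbitrary: S rule: finite_induct)
  case empty
  then show ?case by simp
next
  case (insert a I)
  let ?p = "\<Prod>i\<in>I. [:c i, d i:]"
  have eq: "(\<Prod>i\<in>insert a I. [:c i, d i:]) = smult (c a) ?p + pCons 0 (smult (d a) ?p)"
    using insert.hyps by simp
  show ?case
  proof (cases "a \<in> S")
    case True
    define S' where "S' = S - {a}"
    have S': "S = insert a S'" "a \<notin> S'" "S' \<subseteq> I" "insert a I - S = I - S'" "finite S'"
      using True insert.prems insert.hyps finite_subset[of S' I] by (auto simp: S'_def)
    have "tangible (c a * ((\<Prod>i\<in>S'. c i) * (\<Prod>i\<in>I - S'. d i))) \<le>
        tangible (c a * coeff ?p (card (I - S')))"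
      by (intro tangible_mult_mono insert.IH S' order_refl)
    also have "\<dots> \<le> tangible (coeff (\<Prod>i\<in>insert a I. [:c i, d i:]) (card (I - S')))"
      unfolding eq by (simp add: tangible_add)
    finally show ?thesis using S' by (simp add: mult.assoc)
  next
    case False
    then have S: "S \<subseteq> I" "insert a I - S = insert a (I - S)" "a \<notin> I - S" "finite (I - S)"
      using insert.prems insert.hyps by auto
    have "tangible (d a * ((\<Prod>i\<in>S. c i) * (\<Prod>i\<in>I - S. d i))) \<le>
        tangible (d a * coeff ?p (card (I - S)))"
      by (intro tangible_mult_mono insert.IH S order_refl)
    also have "\<dots> \<le> tangible (coeff (\<Prod>i\<in>insert a I. [:c i, d i:]) (Suc (card (I - S))))"
      unfolding eq by (simp add: tangible_add)
    finally show ?thesis using S by (simp add: mult.left_commute)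
  qed
qed

lemma tangible_sign_mult: "tangible (Elt l 0 * x) = tangible x"
  for x :: "('l::field, 'f::linordered_ab_group_add) elt"
  by (cases x) auto

lemma tangible_prod_sign_mult: "tangible (\<Prod>i\<in>I. Elt l 0 * f i) = tangible (\<Prod>i\<in>I. f i)"
  for f :: "'i \<Rightarrow> ('l::field, 'f::linordered_ab_group_add) elt"
  by (induction I rule: infinite_finite_induct)
    (auto simp: mult.assoc tangible_sign_mult intro: tangible_mult_cong)

text \<open>
  A permutation of \<open>S\<close> is a permutation of all indices that fixes the complement of \<open>S\<close>, where
  \<open>\<lambda>\<close> can be chosen from each diagonal entry of \<open>\<lambda>I - A\<close>. So the weight of the permutation is
  among the terms of the coefficient of \<open>\<lambda>\<close> to the power \<open>n - card S\<close>; the signs affect layers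
  only.
\<close>

lemma tangible_permutation_le_char_coeff:
  fixes A :: "('l::field, 'f::linordered_ab_group_add) elt mat"
  assumes A: "A \<in> carrier_mat n n" and S: "S \<subseteq> {..<n}" and \<sigma>: "\<sigma> permutes S"
  shows "tangible (\<Prod>i\<in>S. A $$ (i, \<sigma> i)) \<le> tangible (char_coeff A (card S))"
proof -
  define c where "c \<sigma> i = Elt (-1) 0 * A $$ (i, \<sigma> i)" for \<sigma> :: "nat \<Rightarrow> nat" and i
  define d :: "(nat \<Rightarrow> nat) \<Rightarrow> nat \<Rightarrow> ('l, 'f) elt" where "d \<sigma> i = (if i = \<sigma> i then 1 else 0)" for \<sigma> i
  define P where "P \<sigma> = (\<Prod>i<n. [:c \<sigma> i, d \<sigma> i:])" for \<sigma>
  let ?k = "card ({..<n} - S)"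
  have k: "dim_row A - card S = ?k"
    using A S by (simp add: card_Diff_subset finite_subset)
  have fixed: "(\<Prod>i\<in>{..<n} - S. d \<sigma> i) = 1"
    using \<sigma> by (intro prod.neutral) (auto simp: d_def permutes_def)
  have "tangible (\<Prod>i\<in>S. A $$ (i, \<sigma> i)) = tangible ((\<Prod>i\<in>S. c \<sigma> i) * (\<Prod>i\<in>{..<n} - S. d \<sigma> i))"
    by (simp add: fixed c_def tangible_prod_sign_mult)
  also have "\<dots> \<le> tangible (coeff (P \<sigma>) ?k)"
    unfolding P_def using S by (intro tangible_le_coeff_prod_linear) auto
  also have "\<dots> = tangible (Elt (of_int (sign \<sigma>)) 0 * coeff (P \<sigma>) ?k)"
    by (simp add: tangible_sign_mult)
  also have "\<dots> \<le> tangible (\<Sum>\<sigma> | \<sigma> permutes {..<n}. Elt (of_int (sign \<sigma>)) 0 * coeff (P \<sigma>) ?k)"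
    using permutes_subset[OF \<sigma> S]
    by (intro tangible_le_sum[where f = "\<lambda>\<sigma>. Elt (of_int (sign \<sigma>)) 0 * coeff (P \<sigma>) ?k"])
      (auto simp: finite_permutations)
  also have "\<dots> = tangible (char_coeff A (card S))"
    by (simp add: char_coeff_def elt_char_poly_expansion[OF A] k coeff_sum P_def c_def d_def)
  finally show ?thesis .
qed

section \<open>Essentiality of the trace monomial\<close>

lemma tangible_monomial_le_other_monomials:
  "tangible (coeff p j * a ^ j) \<le> tangible (poly (other_monomials p i) a)" if "j \<noteq> i"
  for p :: "('l::field, 'f::linordered_ab_group_add) elt poly"
proof (cases "j \<le> degree p")
  case True
  have "poly (other_monomials p i) a = (\<Sum>j\<in>{..degree p} - {i}. coeff p j * a ^ j)"
    by (simp add: other_monomials_def poly_sum poly_monom)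
  then show ?thesis
    using tangible_le_sum[of "{..degree p} - {i}" j "\<lambda>j. coeff p j * a ^ j"] True that by simp
next
  case False
  then show ?thesis by (simp add: coeff_eq_0)
qed

text \<open>
  The other monomials are dominated one by one, and the bound also covers exponents above the
  degree: there the left-hand side is minus infinity, and the right-hand side is not.
\<close>

lemma essential_dominates:
  fixes p :: "('l::field, 'f::linordered_ab_group_add) elt poly"
  assumes "essential p i"
  obtains a where "a \<noteq> 0"
    and "\<And>j. j \<noteq> i \<Longrightarrow> tangible (coeff p j * a ^ j) < tangible (coeff p i * a ^ i)"
proof -
  obtain a where "a \<noteq> MinusInf" "essential_at p i a"
    using assms by (auto simp: essential_def)
  moreover from this have "tangible (coeff p j * a ^ j) < tangible (coeff p i * a ^ i)"
    if "j \<noteq> i" for j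
    using tangible_monomial_le_other_monomials[OF that, of p a]
    unfolding essential_at_def poly_monom by (metis le_less_trans)
  ultimately show ?thesis using that[of a] by (simp add: zero_elt_def)
qed

text \<open>
  At a point \<open>a\<close> where the trace monomial is essential, comparison with the leading monomial
  bounds \<open>a\<close> by the trace, which turns the comparison with \<open>\<alpha>\<^sub>k \<lambda>\<^bsup>n-k\<^esup>\<close> into a bound
  that no longer mentions \<open>a\<close>.
\<close>

lemma char_coeff_less_trace_power:
  fixes A :: "('l::field, 'f::linordered_ab_group_add) elt mat"
  assumes A: "A \<in> carrier_mat n n" and n: "n \<ge> 1"
    and ess: "essential (elt_char_poly A) (n - 1)" and k: "2 \<le> k" "k \<le> n"
  shows "tangible (char_coeff A k) < tangible (elt_trace A ^ k)"
proof -
  let ?T = "elt_trace A"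
  obtain a where a: "a \<noteq> 0"
    and dom: "\<And>j. j \<noteq> n - 1 \<Longrightarrow> tangible (coeff (elt_char_poly A) j * a ^ j) <
      tangible (coeff (elt_char_poly A) (n - 1) * a ^ (n - 1))"
    using essential_dominates[OF ess] by blast
  have dom': "tangible (char_coeff A j * a ^ (n - j)) < tangible (?T * a ^ (n - 1))"
    if "j \<noteq> 1" "j \<le> n" for j
  proof -
    have "tangible (char_coeff A j * a ^ (n - j)) < tangible (char_coeff A 1 * a ^ (n - 1))"
      using dom[of "n - j"] that n A by (simp add: char_coeff_def)
    then show ?thesis
      unfolding char_coeff_1[OF A n] by (simp add: mult.assoc tangible_sign_mult)
  qed
  \<comment> \<open>The empty permutation provides the leading term \<open>\<lambda>\<^sup>n\<close>.\<close>
  have "tangible (1 :: ('l, 'f) elt) \<le> tangible (char_coeff A 0)"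
    using tangible_permutation_le_char_coeff[OF A, of "{}" id] by (simp add: permutes_id)
  then have "tangible (1 * a ^ n) \<le> tangible (char_coeff A 0 * a ^ n)"
    by (intro tangible_mult_mono order_refl)
  also have "\<dots> < tangible (?T * a ^ (n - 1))"
    using dom'[of 0] by simp
  finally have "tangible (a * a ^ (n - 1)) < tangible (?T * a ^ (n - 1))"
    using n by (cases n) auto
  then have aT: "tangible a < tangible ?T"
    by (simp add: tangible_mult_less_cancel_right elt_power_not_zero a)
  have "tangible (char_coeff A k * a ^ (n - k)) < tangible (?T * a ^ (k - 1) * a ^ (n - k))"
    using dom'[of k] k by (simp add: mult.assoc flip: power_add)
  then have "tangible (char_coeff A k) < tangible (?T * a ^ (k - 1))"
    by (simp add: tangible_mult_less_cancel_right elt_power_not_zero a)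
  also have "\<dots> \<le> tangible (?T * ?T ^ (k - 1))"
    using aT by (intro tangible_mult_mono tangible_power_mono) auto
  also have "?T * ?T ^ (k - 1) = ?T ^ k"
    using k by (cases k) auto
  finally show ?thesis .
qed

section \<open>Walks\<close>

text \<open>
  A walk is the list of its vertices, both endpoints included, so a closed walk through the
  vertices \<open>xs\<close> is \<open>xs @ [hd xs]\<close> and has length \<open>length xs\<close>.
\<close>

definition walk_prod :: "'a::comm_monoid_mult mat \<Rightarrow> nat list \<Rightarrow> 'a" where
  "walk_prod A xs = (\<Prod>(i, j)\<leftarrow>zip xs (tl xs). A $$ (i, j))"

lemma walk_prod_singleton [simp]: "walk_prod A [v] = 1"
  by (simp add: walk_prod_def)

lemma walk_prod_Cons_Cons [simp]: "walk_prod A (u # v # xs) = A $$ (u, v) * walk_prod A (v # xs)"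
  by (simp add: walk_prod_def)

lemma walk_prod_append: "walk_prod A (xs @ v # ys) = walk_prod A (xs @ [v]) * walk_prod A (v # ys)"
proof (induction xs)
  case (Cons x xs)
  then show ?case by (cases xs) (auto simp: mult.assoc)
qed simp

text \<open>
  A closed walk that visits \<open>v\<close> twice is cut there into two shorter closed walks, the detour from
  \<open>v\<close> back to \<open>v\<close> and the walk that omits the detour.
\<close>

lemma walk_prod_split_cycle:
  fixes A :: "'a::comm_monoid_mult mat"
  assumes xs: "xs = ys @ [v] @ zs @ [v] @ ws"
  shows "walk_prod A (xs @ [hd xs]) =
    walk_prod A ((ys @ v # ws) @ [hd (ys @ v # ws)]) * walk_prod A ((v # zs) @ [v])"
proof -
  have hd: "hd xs = hd (ys @ v # ws)" by (cases ys) (auto simp: xs)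
  show ?thesis
    unfolding hd unfolding xs
    using walk_prod_append[of A ys v "zs @ v # ws @ [hd (ys @ v # ws)]"]
      walk_prod_append[of A "v # zs" v "ws @ [hd (ys @ v # ws)]"]
      walk_prod_append[of A ys v "ws @ [hd (ys @ v # ws)]"]
    by (simp add: mult_ac)
qed

lemma walk_prod_simple_cycle:
  fixes A :: "'a::comm_monoid_mult mat"
  assumes "distinct xs" "xs \<noteq> []"
  shows "walk_prod A (xs @ [hd xs]) = (\<Prod>i\<in>set xs. A $$ (i, cycle_of_list xs i))"
proof -
  have "map (cycle_of_list xs) xs = tl xs @ [hd xs]"
    using cyclic_rotation[of xs 1] assms by (simp add: rotate1_hd_tl)
  moreover have "zip (xs @ [hd xs]) (tl xs @ [hd xs]) = zip xs (tl xs @ [hd xs])"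
    using zip_append[of xs "tl xs @ [hd xs]" "[hd xs]" "[]"] assms(2) by simp
  ultimately have "zip (xs @ [hd xs]) (tl (xs @ [hd xs])) = zip xs (map (cycle_of_list xs) xs)"
    using assms(2) by simp
  then show ?thesis
    using assms
    by (simp add: walk_prod_def prod.distinct_set_conv_list zip_map2 zip_same_conv_map o_def)
qed

text \<open>
  By induction on the length: a closed walk with a repeated vertex splits into two shorter ones,
  and a simple cycle is a loop or the weight of a cyclic permutation of at least two
  indices. The weak bound is part of the claim because, when the walk is split, one of the two
  parts may be the constant walk at \<open>c\<close>, for which equality holds.
\<close>

lemma closed_walk_less:
  fixes A :: "('l::field, 'f::linordered_ab_group_add) elt mat"
  assumes diag: "\<And>i. i < n \<Longrightarrow> i \<noteq> c \<Longrightarrow> tangible (A $$ (i, i)) < tangible (A $$ (c, c))"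
    and perm: "\<And>S \<sigma>. S \<subseteq> {..<n} \<Longrightarrow> 2 \<le> card S \<Longrightarrow> \<sigma> permutes S \<Longrightarrow>
      tangible (\<Prod>i\<in>S. A $$ (i, \<sigma> i)) < tangible (A $$ (c, c) ^ card S)"
    and D: "A $$ (c, c) \<noteq> 0"
    and xs: "xs \<noteq> []" "set xs \<subseteq> {..<n}"
  shows "tangible (walk_prod A (xs @ [hd xs])) \<le> tangible (A $$ (c, c) ^ length xs) \<and>
    (set xs \<noteq> {c} \<longrightarrow> tangible (walk_prod A (xs @ [hd xs])) < tangible (A $$ (c, c) ^ length xs))"
  using xs
proof (induction "length xs" arbitrary: xs rule: less_induct)
  case less
  let ?D = "A $$ (c, c)"
  show ?case
  proof (cases "distinct xs")
    case True
    show ?thesis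
    proof (cases "length xs = 1")
      case True
      then obtain v where "xs = [v]" by (auto simp: length_Suc_conv)
      then show ?thesis using diag[of v] less.prems by (cases "v = c") auto
    next
      case False
      then have "2 \<le> length xs" using less.prems by (cases xs) (auto simp: Suc_le_eq)
      then show ?thesis
        using perm[OF less.prems(2), of "cycle_of_list xs"] cycle_permutes[of xs] True
        by (simp add: walk_prod_simple_cycle less.prems distinct_card less_imp_le)
    qed
  next
    case False
    then obtain ys v zs ws where eq: "xs = ys @ [v] @ zs @ [v] @ ws"
      using not_distinct_decomp by blast
    let ?us = "ys @ v # ws" and ?vs = "v # zs"
    have us: "tangible (walk_prod A (?us @ [hd ?us])) \<le> tangible (?D ^ length ?us) \<and>
        (set ?us \<noteq> {c} \<longrightarrow> tangible (walk_prod A (?us @ [hd ?us])) < tangible (?D ^ length ?us))"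
      by (rule less.hyps) (use less.prems eq in auto)
    have vs: "tangible (walk_prod A (?vs @ [hd ?vs])) \<le> tangible (?D ^ length ?vs) \<and>
        (set ?vs \<noteq> {c} \<longrightarrow> tangible (walk_prod A (?vs @ [hd ?vs])) < tangible (?D ^ length ?vs))"
      by (rule less.hyps) (use less.prems eq in auto)
    have split: "walk_prod A (xs @ [hd xs]) =
        walk_prod A (?us @ [hd ?us]) * walk_prod A (?vs @ [hd ?vs])"
      using walk_prod_split_cycle[OF eq] by simp
    have len: "?D ^ length xs = ?D ^ length ?us * ?D ^ length ?vs"
      unfolding power_add[symmetric] by (simp add: eq ac_simps)
    have nz: "?D ^ k \<noteq> 0" for k by (rule elt_power_not_zero[OF D])
    show ?thesis
    proof (intro conjI impI)
      show "tangible (walk_prod A (xs @ [hd xs])) \<le> tangible (?D ^ length xs)"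
        unfolding split len using us vs by (blast intro: tangible_mult_mono)
      assume "set xs \<noteq> {c}"
      moreover have "set xs = set ?us \<union> set ?vs" by (auto simp: eq)
      ultimately consider "set ?us \<noteq> {c}" | "set ?vs \<noteq> {c}" by auto
      then show "tangible (walk_prod A (xs @ [hd xs])) < tangible (?D ^ length xs)"
      proof cases
        case 1
        then show ?thesis unfolding split len
          using us vs nz by (blast intro: tangible_mult_less_le)
      next
        case 2
        then show ?thesis unfolding split len
          using us vs nz
          by (subst (1 2) mult.commute) (blast intro: tangible_mult_less_le)
      qed
    qed
  qed
qed

text \<open>
  An entry of \<open>A\<^sup>m\<close> is a sum over the walks of length \<open>m\<close>. Only the weight of a heaviest walk
  matters below, so its existence replaces the explicit sum.
\<close>

lemma pow_mat_entry_attained_by_walk: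
  fixes A :: "('l::field, 'f::linordered_ab_group_add) elt mat"
  assumes A: "A \<in> carrier_mat n n"
  shows "i < n \<Longrightarrow> j < n \<Longrightarrow> (A ^\<^sub>m m) $$ (i, j) \<noteq> 0 \<Longrightarrow>
    \<exists>xs. length xs = m \<and> set xs \<subseteq> {..<n} \<and> hd (xs @ [j]) = i \<and>
      tangible (walk_prod A (xs @ [j])) = tangible ((A ^\<^sub>m m) $$ (i, j))"
proof (induction m arbitrary: j)
  case 0
  then show ?case using A by (auto split: if_splits)
next
  case (Suc m)
  have entry: "(A ^\<^sub>m Suc m) $$ (i, j) = (\<Sum>k<n. (A ^\<^sub>m m) $$ (i, k) * A $$ (k, j))"
    using A Suc.prems by (simp add: scalar_prod_def lessThan_atLeast0)
  obtain k where k: "k < n"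
    and eq: "tangible ((A ^\<^sub>m m) $$ (i, k) * A $$ (k, j)) = tangible ((A ^\<^sub>m Suc m) $$ (i, j))"
    using tangible_sum_attained[of "\<lambda>k. (A ^\<^sub>m m) $$ (i, k) * A $$ (k, j)" "{..<n}"] Suc.prems
    unfolding entry by auto
  have "(A ^\<^sub>m m) $$ (i, k) \<noteq> 0"
    using eq Suc.prems by (metis mult_zero_left tangible_eq_Bot_iff)
  then obtain xs where xs: "length xs = m" "set xs \<subseteq> {..<n}" "hd (xs @ [k]) = i"
    "tangible (walk_prod A (xs @ [k])) = tangible ((A ^\<^sub>m m) $$ (i, k))"
    using Suc.IH[of k] k Suc.prems by blast
  have "tangible (walk_prod A ((xs @ [k]) @ [j])) = tangible ((A ^\<^sub>m Suc m) $$ (i, j))"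
    unfolding eq[symmetric]
    using walk_prod_append[of A xs k "[j]"] xs(4) by (auto intro: tangible_mult_cong)
  moreover have "hd ((xs @ [k]) @ [j]) = i" using xs(3) by (cases xs) auto
  ultimately show ?case using xs k by (intro exI[of _ "xs @ [k]"]) auto
qed

text \<open>
  In the product \<open>A\<^sup>m A\<close>, every summand of the entry \<open>(c, c)\<close> that passes through some
  \<open>k \<noteq> c\<close> just before the end has the weight of a closed walk that leaves \<open>c\<close>, and is therefore
  strictly dominated by the constant walk.
\<close>

lemma pow_mat_critical_entry:
  fixes A :: "('l::field, 'f::linordered_ab_group_add) elt mat"
  assumes A: "A \<in> carrier_mat n n" and c: "c < n" and D: "A $$ (c, c) \<noteq> 0"
    and diag: "\<And>i. i < n \<Longrightarrow> i \<noteq> c \<Longrightarrow> tangible (A $$ (i, i)) < tangible (A $$ (c, c))"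
    and perm: "\<And>S \<sigma>. S \<subseteq> {..<n} \<Longrightarrow> 2 \<le> card S \<Longrightarrow> \<sigma> permutes S \<Longrightarrow>
      tangible (\<Prod>i\<in>S. A $$ (i, \<sigma> i)) < tangible (A $$ (c, c) ^ card S)"
  shows "(A ^\<^sub>m m) $$ (c, c) = A $$ (c, c) ^ m"
proof (induction m)
  case 0
  show ?case using A c by simp
next
  case (Suc m)
  let ?D = "A $$ (c, c)"
  let ?f = "\<lambda>k. (A ^\<^sub>m m) $$ (c, k) * A $$ (k, c)"
  have fc: "?f c = ?D ^ Suc m" by (simp add: Suc.IH mult.commute)
  have nz: "?f c \<noteq> 0" unfolding fc by (rule elt_power_not_zero[OF D])
  have less: "tangible (?f k) < tangible (?f c)" if k: "k < n" "k \<noteq> c" for k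
  proof (cases "(A ^\<^sub>m m) $$ (c, k) = 0")
    case True
    then show ?thesis using nz tangible_zero_less[of "?f c"] by simp
  next
    case False
    then obtain xs where xs: "length xs = m" "set xs \<subseteq> {..<n}" "hd (xs @ [k]) = c"
      "tangible (walk_prod A (xs @ [k])) = tangible ((A ^\<^sub>m m) $$ (c, k))"
      using pow_mat_entry_attained_by_walk[OF A c k(1)] by blast
    have "tangible (?f k) = tangible (walk_prod A ((xs @ [k]) @ [hd (xs @ [k])]))"
      using walk_prod_append[of A xs k "[c]"] xs(3,4)
      by (auto intro: tangible_mult_cong)
    also have "\<dots> < tangible (?D ^ length (xs @ [k]))"
    proof -
      have "xs @ [k] \<noteq> []" "set (xs @ [k]) \<subseteq> {..<n}" "set (xs @ [k]) \<noteq> {c}"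
        using xs(2) k by auto
      then show ?thesis
        using closed_walk_less[where xs = "xs @ [k]", OF diag perm D] by blast
    qed
    finally show ?thesis using xs(1) fc by simp
  qed
  have "(A ^\<^sub>m Suc m) $$ (c, c) = (\<Sum>k<n. ?f k)"
    using A c by (simp add: scalar_prod_def lessThan_atLeast0)
  also have "\<dots> = ?f c"
    using c nz less by (intro sum_eq_dominant_term) auto
  finally show ?case unfolding fc .
qed

lemma layer_trace_eq_0:
  fixes A :: "('l::field, 'f::linordered_ab_group_add) elt mat"
  assumes A: "A \<in> carrier_mat n n" and n: "n \<ge> 1"
    and ess: "essential (elt_char_poly A) (n - 1)" and nil: "elt_nilpotent A"
  shows "layer (elt_trace A) = 0"
proof (cases "elt_trace A = 0")
  case True
  then show ?thesis by (simp add: zero_elt_def)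
next
  case T0: False
  let ?T = "elt_trace A"
  have T: "?T = (\<Sum>i<n. A $$ (i, i))" using A by (simp add: elt_trace_def)
  obtain c where c: "c < n" and D: "tangible (A $$ (c, c)) = tangible ?T"
    using tangible_sum_attained[of "\<lambda>i. A $$ (i, i)" "{..<n}"] T0 unfolding T by auto
  have D0: "A $$ (c, c) \<noteq> 0" using D T0 by (metis tangible_eq_Bot_iff)
  have DT: "tangible (A $$ (c, c) ^ k) = tangible (?T ^ k)" for k
    using D by (intro antisym tangible_power_mono) auto
  have perm: "tangible (\<Prod>i\<in>S. A $$ (i, \<sigma> i)) < tangible (A $$ (c, c) ^ card S)"
    if S: "S \<subseteq> {..<n}" "2 \<le> card S" "\<sigma> permutes S" for S \<sigma>
  proof -
    have "card S \<le> n" using card_mono[OF _ S(1)] by simp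
    then show ?thesis
      unfolding DT
      using tangible_permutation_le_char_coeff[OF A S(1,3)]
        char_coeff_less_trace_power[OF A n ess S(2)] by (meson le_less_trans)
  qed
  \<comment> \<open>The loops at \<open>i\<close> and \<open>c\<close> together are the identity permutation of \<open>{i, c}\<close>.\<close>
  have diag: "tangible (A $$ (i, i)) < tangible (A $$ (c, c))" if "i < n" "i \<noteq> c" for i
  proof -
    have "tangible (A $$ (i, i) * A $$ (c, c)) < tangible (A $$ (c, c) * A $$ (c, c))"
      using perm[of "{i, c}" id] that c by (simp add: permutes_id power2_eq_square)
    then show ?thesis by (simp add: tangible_mult_less_cancel_right D0)
  qed
  have "?T = A $$ (c, c)"
    unfolding T using c D0 diag by (intro sum_eq_dominant_term) auto
  moreover obtain m where "\<forall>x \<in> elements_mat (A ^\<^sub>m m). layer x = 0"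
    using nil by (auto simp: elt_nilpotent_def)
  then have "layer ((A ^\<^sub>m m) $$ (c, c)) = 0"
    using A c by (auto simp: elements_mat_def)
  then have "layer (A $$ (c, c)) ^ m = 0"
    by (simp add: pow_mat_critical_entry[OF A c D0 diag perm] layer_power D0)
  ultimately show ?thesis by simp
qed

theorem corollary3p22:
  fixes A :: "('l::field, 'f::divisible_linordered_ab_group_add) elt mat"
    and n :: nat
  assumes "n \<ge> 1"
    and "A \<in> carrier_mat n n"
    and "elt_nilpotent A"
  shows "layer (essential_trace A) = 0"
proof (cases "essential (elt_char_poly A) (n - 1)")
  case True
  then show ?thesis using layer_trace_eq_0 assms by (simp add: essential_trace_def)
next
  case False
  then show ?thesis
    using assms by (cases "char_slope A (elt_mu A)") (auto simp: essential_trace_def)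
qed

end
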